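(* Let $A=(A,\cdot,\circ)$ be a skew brace with associated solution $(A,r_A)$. Then $A$ is a bi-skew brace if and only if $(A,r_A)$ satisfies, for all $x,y\in A$, $$\sigma_{\hat{\sigma}_x(y)}=\sigma_y.$$
   Context: A skew brace (meaning skew left brace) is a set $A$ with two group structures $(A,\cdot)$ (the additive group) and $(A,\circ)$ (the multiplicative group) such that $a\circ(b\cdot c)=(a\circ b)\cdot a^{-1}\cdot(a\circ c)$ for all $a,b,c\in A$, where $a^{-1}$ is the inverse of $a$ in $(A,\cdot)$; $\overline{a}$ denotes the inverse of $a$ in $(A,\circ)$. A bi-skew brace is a skew brace $(A,\cdot,\circ)$ such that $(A,\circ,\cdot)$ is also a skew brace. The gamma function of $A$ is $\gamma\colon(A,\circ)\to\operatorname{Aut}(A,\cdot)$, $\gamma(a)(b)=a^{-1}\cdot(a\circ b)$. A solution is a pair $(X,r)$ with $X$ a nonempty set and $r\colon X^2\to X^2$ a bijection with $r_1r_2r_1=r_2r_1r_2$ on $X^3$, where $r_1=r\times\mathrm{id}_X$ and $r_2=\mathrm{id}_X\times r$, that is nondegenerate: writing $r(x,y)=(\sigma_x(y),\tau_y(x))$, all maps $\sigma_x,\tau_x\colon X\to X$ are bijective. Then $(X,r^{-1})$ is also a solution, and one writes $r^{-1}(x,y)=(\hat\sigma_x(y),\hat\tau_y(x))$. The solution associated with the skew brace $A$ is $(A,r_A)$ with $r_A(a,b)=\big(\gamma(a)(b),\ \overline{\gamma(a)(b)}\circ a\circ b\big)$. *)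

theory Defs
  imports "HOL-Algebra.Group"
begin

section \<open>Skew braces\<close>

text \<open>
  The additive group \<^term>\<open>A\<close> and the multiplicative group \<^term>\<open>M\<close> are two group records on the
  same carrier. The additive group need not be abelian.
\<close>

locale skew_brace = additive: group A + multiplicative: group M
  for A :: "('a, 'm) monoid_scheme" and M :: "('a, 'n) monoid_scheme" +
  assumes carrier_eq: "carrier M = carrier A"
    and compat: "\<lbrakk>a \<in> carrier A; b \<in> carrier A; c \<in> carrier A\<rbrakk> \<Longrightarrow>
      a \<otimes>\<^bsub>M\<^esub> (b \<otimes>\<^bsub>A\<^esub> c) = (a \<otimes>\<^bsub>M\<^esub> b) \<otimes>\<^bsub>A\<^esub> inv\<^bsub>A\<^esub> a \<otimes>\<^bsub>A\<^esub> (a \<otimes>\<^bsub>M\<^esub> c)"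

definition bi_skew_brace :: "('a, 'm) monoid_scheme \<Rightarrow> ('a, 'n) monoid_scheme \<Rightarrow> bool" where
  "bi_skew_brace A M \<longleftrightarrow> skew_brace A M \<and> skew_brace M A"

definition skew_gamma :: "('a, 'm) monoid_scheme \<Rightarrow> ('a, 'n) monoid_scheme \<Rightarrow> 'a \<Rightarrow> 'a \<Rightarrow> 'a" where
  "skew_gamma A M a b = inv\<^bsub>A\<^esub> a \<otimes>\<^bsub>A\<^esub> (a \<otimes>\<^bsub>M\<^esub> b)"


section \<open>Set-theoretic solutions of the Yang--Baxter equation\<close>

text \<open>
  The component maps are \<^const>\<open>undefined\<close> outside \<^term>\<open>X\<close>, so that equality of
  \<open>sol_sigma X r x\<close> and \<open>sol_sigma X r y\<close> in HOL is equality of maps from \<^term>\<open>X\<close> to \<^term>\<open>X\<close>.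
\<close>

definition sol_sigma :: "'a set \<Rightarrow> ('a \<times> 'a \<Rightarrow> 'a \<times> 'a) \<Rightarrow> 'a \<Rightarrow> 'a \<Rightarrow> 'a" where
  "sol_sigma X r x = (\<lambda>y\<in>X. fst (r (x, y)))"

definition sol_tau :: "'a set \<Rightarrow> ('a \<times> 'a \<Rightarrow> 'a \<times> 'a) \<Rightarrow> 'a \<Rightarrow> 'a \<Rightarrow> 'a" where
  "sol_tau X r y = (\<lambda>x\<in>X. snd (r (x, y)))"

definition braid_1 :: "('a \<times> 'a \<Rightarrow> 'a \<times> 'a) \<Rightarrow> 'a \<times> 'a \<times> 'a \<Rightarrow> 'a \<times> 'a \<times> 'a" where
  "braid_1 r = (\<lambda>(x, y, z). (fst (r (x, y)), snd (r (x, y)), z))"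

definition braid_2 :: "('a \<times> 'a \<Rightarrow> 'a \<times> 'a) \<Rightarrow> 'a \<times> 'a \<times> 'a \<Rightarrow> 'a \<times> 'a \<times> 'a" where
  "braid_2 r = (\<lambda>(x, y, z). (x, r (y, z)))"

definition ybe_solution :: "'a set \<Rightarrow> ('a \<times> 'a \<Rightarrow> 'a \<times> 'a) \<Rightarrow> bool" where
  "ybe_solution X r \<longleftrightarrow>
     X \<noteq> {} \<and>
     bij_betw r (X \<times> X) (X \<times> X) \<and>
     (\<forall>t \<in> X \<times> X \<times> X. braid_1 r (braid_2 r (braid_1 r t)) = braid_2 r (braid_1 r (braid_2 r t))) \<and>
     (\<forall>x \<in> X. bij_betw (sol_sigma X r x) X X \<and> bij_betw (sol_tau X r x) X X)"

definition inverse_solution :: "'a set \<Rightarrow> ('a \<times> 'a \<Rightarrow> 'a \<times> 'a) \<Rightarrow> 'a \<times> 'a \<Rightarrow> 'a \<times> 'a" where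
  "inverse_solution X r = inv_into (X \<times> X) r"

definition brace_solution ::
    "('a, 'm) monoid_scheme \<Rightarrow> ('a, 'n) monoid_scheme \<Rightarrow> 'a \<times> 'a \<Rightarrow> 'a \<times> 'a" where
  "brace_solution A M = (\<lambda>(a, b).
     (skew_gamma A M a b, inv\<^bsub>M\<^esub> (skew_gamma A M a b) \<otimes>\<^bsub>M\<^esub> a \<otimes>\<^bsub>M\<^esub> b))"


section \<open>The map associated with a skew brace is a solution\<close>

context skew_brace
begin

abbreviation (input) "C \<equiv> carrier A"
abbreviation (input) "g \<equiv> skew_gamma A M"
abbreviation (input) "iM \<equiv> m_inv M"
abbreviation (input) "iA \<equiv> m_inv A"
abbreviation (input) add (infixl "\<oplus>" 65) where "x \<oplus> y \<equiv> x \<otimes>\<^bsub>A\<^esub> y"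
abbreviation (input) mul (infixl "\<odot>" 70) where "x \<odot> y \<equiv> x \<otimes>\<^bsub>M\<^esub> y"

lemma mul_closed [simp, intro]: "a \<in> C \<Longrightarrow> b \<in> C \<Longrightarrow> a \<odot> b \<in> C"
  using multiplicative.m_closed carrier_eq by auto

lemma iM_closed [simp, intro]: "a \<in> C \<Longrightarrow> iM a \<in> C"
  using multiplicative.inv_closed carrier_eq by auto

lemma one_M_closed [simp, intro]: "\<one>\<^bsub>M\<^esub> \<in> C"
  using multiplicative.one_closed carrier_eq by auto

lemma mul_assoc: "a \<in> C \<Longrightarrow> b \<in> C \<Longrightarrow> c \<in> C \<Longrightarrow> a \<odot> b \<odot> c = a \<odot> (b \<odot> c)"
  using multiplicative.m_assoc carrier_eq by auto

lemma mul_inv_cancel: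
  assumes "a \<in> C" "b \<in> C"
  shows "a \<odot> (iM a \<odot> b) = b" "iM a \<odot> (a \<odot> b) = b"
  using assms carrier_eq
  by (metis multiplicative.inv_solve_left mul_closed iM_closed
      multiplicative.inv_solve_left')+

lemma add_inv_cancel:
  assumes "a \<in> C" "b \<in> C"
  shows "a \<oplus> (iA a \<oplus> b) = b" "iA a \<oplus> (a \<oplus> b) = b"
  using assms by (simp_all flip: additive.m_assoc)

lemma gamma_closed [simp, intro]: "a \<in> C \<Longrightarrow> b \<in> C \<Longrightarrow> g a b \<in> C"
  by (auto simp: skew_gamma_def)

lemma mul_eq: "a \<in> C \<Longrightarrow> b \<in> C \<Longrightarrow> a \<odot> b = a \<oplus> g a b"
  by (simp add: skew_gamma_def add_inv_cancel)

lemma gamma_add: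
  assumes "a \<in> C" "b \<in> C" "c \<in> C"
  shows "g a (b \<oplus> c) = g a b \<oplus> g a c"
  using assms by (simp add: skew_gamma_def compat additive.m_assoc)

lemma gamma_mul:
  assumes "a \<in> C" "b \<in> C" "c \<in> C"
  shows "g (a \<odot> b) c = g a (g b c)"
proof -
  have "a \<oplus> (g a b \<oplus> g a (g b c)) = a \<oplus> g a (b \<odot> c)"
    using assms by (simp add: gamma_add mul_eq[of b c])
  also have "\<dots> = (a \<odot> b) \<odot> c"
    using assms by (metis mul_eq mul_assoc mul_closed)
  also have "\<dots> = (a \<odot> b) \<oplus> g (a \<odot> b) c"
    using assms by (simp add: mul_eq[of "a \<odot> b" c])
  also have "\<dots> = (a \<oplus> g a b) \<oplus> g (a \<odot> b) c"
    using assms by (metis mul_eq)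
  also have "\<dots> = a \<oplus> (g a b \<oplus> g (a \<odot> b) c)"
    using assms by (simp add: additive.m_assoc)
  finally show ?thesis using assms by simp
qed

lemma gamma_one: "b \<in> C \<Longrightarrow> g \<one>\<^bsub>M\<^esub> b = b"
proof -
  assume b: "b \<in> C"
  have e: "\<one>\<^bsub>M\<^esub> \<odot> x = x" if "x \<in> C" for x
    using that carrier_eq by auto
  have "\<one>\<^bsub>M\<^esub> \<oplus> g \<one>\<^bsub>M\<^esub> \<one>\<^bsub>A\<^esub> = \<one>\<^bsub>A\<^esub>"
    using mul_eq[of "\<one>\<^bsub>M\<^esub>" "\<one>\<^bsub>A\<^esub>"] e by simp
  moreover have "g \<one>\<^bsub>M\<^esub> \<one>\<^bsub>A\<^esub> = \<one>\<^bsub>A\<^esub>"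
    using gamma_add[of "\<one>\<^bsub>M\<^esub>" "\<one>\<^bsub>A\<^esub>" "\<one>\<^bsub>A\<^esub>"]
    by (simp add: additive.r_cancel_one')
  ultimately have "\<one>\<^bsub>M\<^esub> = \<one>\<^bsub>A\<^esub>" by simp
  then show ?thesis using b e[OF b] by (simp add: skew_gamma_def)
qed

lemma gamma_inv:
  assumes "a \<in> C" "b \<in> C"
  shows "g a (g (iM a) b) = b" "g (iM a) (g a b) = b"
proof -
  have "a \<odot> iM a = \<one>\<^bsub>M\<^esub>" "iM a \<odot> a = \<one>\<^bsub>M\<^esub>" using assms carrier_eq by auto
  then show "g a (g (iM a) b) = b" "g (iM a) (g a b) = b"
    using assms by (metis gamma_mul gamma_one iM_closed)+
qed

lemma gamma_inv_add:
  assumes "a \<in> C" "b \<in> C"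
  shows "g a (iA b) = iA (g a b)"
proof -
  have "g a \<one>\<^bsub>A\<^esub> = \<one>\<^bsub>A\<^esub>"
    using gamma_add[of a "\<one>\<^bsub>A\<^esub>" "\<one>\<^bsub>A\<^esub>"] assms by (simp add: additive.r_cancel_one')
  then have "g a (iA b) \<oplus> g a b = \<one>\<^bsub>A\<^esub>"
    using assms by (simp flip: gamma_add)
  then show ?thesis using assms by (simp add: additive.inv_equality)
qed

abbreviation (input) "r \<equiv> brace_solution A M"

lemma r_closed: "a \<in> C \<Longrightarrow> b \<in> C \<Longrightarrow> fst (r (a, b)) \<in> C \<and> snd (r (a, b)) \<in> C"
  by (auto simp: brace_solution_def)

lemma r_mul:
  assumes "a \<in> C" "b \<in> C"
  shows "fst (r (a, b)) \<odot> snd (r (a, b)) = a \<odot> b"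
  using assms by (simp add: brace_solution_def mul_assoc mul_inv_cancel)

lemma r_fst: "fst (r (a, b)) = g a b"
  by (simp add: brace_solution_def)

lemma r_bij: "bij_betw r (C \<times> C) (C \<times> C)"
proof (rule bij_betw_byWitness[where f' =
      "\<lambda>(u, v). (u \<odot> v \<oplus> iA u, iM (u \<odot> v \<oplus> iA u) \<odot> (u \<odot> v))"])
  show "\<forall>t\<in>C \<times> C. (case r t of (u, v) \<Rightarrow>
      (u \<odot> v \<oplus> iA u, iM (u \<odot> v \<oplus> iA u) \<odot> (u \<odot> v))) = t"
  proof clarify
    fix a b assume ab: "a \<in> C" "b \<in> C"
    obtain u v where uv: "r (a, b) = (u, v)" by fastforce
    have p: "u \<odot> v = a \<odot> b" and u: "u = g a b" using r_mul[OF ab] r_fst[of a b] uv by auto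
    have "u \<odot> v \<oplus> iA u = a"
      unfolding p unfolding u using ab by (simp add: mul_eq additive.m_assoc)
    then show "(case r (a, b) of (u, v) \<Rightarrow>
      (u \<odot> v \<oplus> iA u, iM (u \<odot> v \<oplus> iA u) \<odot> (u \<odot> v))) = (a, b)"
      using ab by (simp add: uv p mul_inv_cancel)
  qed
  show "\<forall>t\<in>C \<times> C. r (case t of (u, v) \<Rightarrow>
      (u \<odot> v \<oplus> iA u, iM (u \<odot> v \<oplus> iA u) \<odot> (u \<odot> v))) = t"
  proof
    fix t assume "t \<in> C \<times> C"
    then obtain u v where t: "t = (u, v)" and uv: "u \<in> C" "v \<in> C" by blast
    define a where "a = u \<odot> v \<oplus> iA u"
    have a: "a \<in> C" unfolding a_def using uv by auto
    define b where "b = iM a \<odot> (u \<odot> v)"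
    have b: "b \<in> C" unfolding b_def using uv a by auto
    have ab: "a \<odot> b = u \<odot> v" using uv a by (simp add: b_def mul_inv_cancel)
    have "g a b = u"
      unfolding skew_gamma_def ab unfolding a_def using uv
      by (simp add: additive.inv_mult_group additive.m_assoc)
    then have "r (a, b) = (u, v)"
      using a b uv ab by (simp add: brace_solution_def mul_assoc mul_inv_cancel)
    then show "r (case t of (u, v) \<Rightarrow>
      (u \<odot> v \<oplus> iA u, iM (u \<odot> v \<oplus> iA u) \<odot> (u \<odot> v))) = t"
      by (simp add: t a_def b_def)
  qed
qed (auto simp: brace_solution_def)

lemma r_braid:
  assumes a: "a \<in> C" and b: "b \<in> C" and c: "c \<in> C"
  shows "braid_1 r (braid_2 r (braid_1 r (a, b, c))) = braid_2 r (braid_1 r (braid_2 r (a, b, c)))"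
proof -
  obtain u v where 1: "r (a, b) = (u, v)" by fastforce
  obtain v1 w where 2: "r (v, c) = (v1, w)" by fastforce
  obtain u2 v2 where 3: "r (u, v1) = (u2, v2)" by fastforce
  obtain b1 c1 where 4: "r (b, c) = (b1, c1)" by fastforce
  obtain a2 b2 where 5: "r (a, b1) = (a2, b2)" by fastforce
  obtain b3 c3 where 6: "r (b2, c1) = (b3, c3)" by fastforce
  have cl [simp]: "u \<in> C" "v \<in> C" using r_closed[OF a b] 1 by auto
  have [simp]: "v1 \<in> C" "w \<in> C" using r_closed[of v c] c 2 by auto
  have [simp]: "u2 \<in> C" "v2 \<in> C" using r_closed[of u v1] 3 by auto
  have [simp]: "b1 \<in> C" "c1 \<in> C" using r_closed[OF b c] 4 by auto
  have [simp]: "a2 \<in> C" "b2 \<in> C" using r_closed[of a b1] a 5 by auto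
  have [simp]: "b3 \<in> C" "c3 \<in> C" using r_closed[of b2 c1] 6 by auto
  note [simp] = a b c
  have g: "u = g a b" "v1 = g v c" "u2 = g u v1" "b1 = g b c" "a2 = g a b1" "b3 = g b2 c1"
    using r_fst 1 2 3 4 5 6 by (metis fst_conv)+
  have m: "u \<odot> v = a \<odot> b" "v1 \<odot> w = v \<odot> c" "u2 \<odot> v2 = u \<odot> v1"
    "b1 \<odot> c1 = b \<odot> c" "a2 \<odot> b2 = a \<odot> b1" "b3 \<odot> c3 = b2 \<odot> c1"
    using r_mul[of a b] r_mul[of v c] r_mul[of u v1] r_mul[of b c] r_mul[of a b1] r_mul[of b2 c1]
      1 2 3 4 5 6 by simp_all
  have u2: "u2 = g (a \<odot> b) c"
    unfolding g(3) g(2) m(1)[symmetric] by (simp add: gamma_mul)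
  have a2: "a2 = g (a \<odot> b) c"
    unfolding g(5) g(4) by (simp add: gamma_mul)
  have e1: "u2 = a2" using u2 a2 by simp
  have "u2 \<odot> v2 = u \<oplus> a2"
    unfolding m(3) using mul_eq[of u v1] g(3) e1 by simp
  moreover have "a2 \<odot> b3 = u \<oplus> a2"
  proof -
    have "g a2 b3 = g (a2 \<odot> b2) c1" unfolding g(6) by (simp add: gamma_mul)
    also have "\<dots> = g a (g b1 c1)" unfolding m(5) by (simp add: gamma_mul)
    also have "g b1 c1 = iA b1 \<oplus> (b \<odot> c)" unfolding skew_gamma_def m(4) ..
    also have "b \<odot> c = b \<oplus> b1" unfolding g(4) by (simp add: mul_eq)
    also have "g a (iA b1 \<oplus> (b \<oplus> b1)) = iA a2 \<oplus> (u \<oplus> a2)"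
      unfolding g(1) g(5) by (simp add: gamma_add gamma_inv_add)
    finally show ?thesis by (simp add: mul_eq[of a2 b3] add_inv_cancel)
  qed
  ultimately have e2: "v2 = b3"
    using e1 by (metis mul_inv_cancel(2) \<open>v2 \<in> C\<close> \<open>b3 \<in> C\<close> \<open>a2 \<in> C\<close>)
  have "u2 \<odot> v2 \<odot> w = a \<odot> b \<odot> c"
    unfolding m(3) by (simp add: mul_assoc m(2)) (simp add: m(1) flip: mul_assoc)
  moreover have "a2 \<odot> b3 \<odot> c3 = a \<odot> b \<odot> c"
  proof -
    have "a2 \<odot> b3 \<odot> c3 = a2 \<odot> b2 \<odot> c1" by (simp add: mul_assoc m(6))
    also have "\<dots> = a \<odot> (b1 \<odot> c1)" unfolding m(5) by (simp add: mul_assoc)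
    finally show ?thesis unfolding m(4) by (simp add: mul_assoc)
  qed
  ultimately have e3: "w = c3"
    using e1 e2 by (metis mul_inv_cancel(2) \<open>w \<in> C\<close> \<open>c3 \<in> C\<close> \<open>a2 \<in> C\<close> \<open>b3 \<in> C\<close> mul_closed)
  show ?thesis by (simp add: braid_1_def braid_2_def 1 2 3 4 5 6 e1 e2 e3)
qed

lemma sigma_bij:
  assumes "a \<in> C"
  shows "bij_betw (sol_sigma C r a) C C"
  by (rule bij_betw_byWitness[where f' = "g (iM a)"])
    (use assms in \<open>auto simp: sol_sigma_def r_fst gamma_inv\<close>)

lemma tau_inv:
  assumes "a \<in> C" "b \<in> C"
  shows "snd (r (a, b)) = iM (iM b \<odot> (iM a \<oplus> b))"
proof -
  have "iM a \<oplus> b = iM a \<odot> g a b"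
    using assms by (simp add: mul_eq[of "iM a"] gamma_inv)
  then show ?thesis
    using assms carrier_eq
    by (simp add: brace_solution_def multiplicative.inv_mult_group mul_assoc)
qed

lemma tau_bij:
  assumes b: "b \<in> C"
  shows "bij_betw (sol_tau C r b) C C"
proof (rule bij_betw_byWitness[where f' = "\<lambda>y. iM (b \<odot> iM y \<oplus> iA b)"])
  have ii: "iM (iM x) = x" if "x \<in> C" for x using that carrier_eq by simp
  show "\<forall>a\<in>C. iM (b \<odot> iM (sol_tau C r b a) \<oplus> iA b) = a"
    using b by (simp add: sol_tau_def tau_inv ii mul_inv_cancel additive.m_assoc)
  show "\<forall>y\<in>C. sol_tau C r b (iM (b \<odot> iM y \<oplus> iA b)) = y"
    using b by (simp add: sol_tau_def tau_inv ii mul_inv_cancel additive.m_assoc)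
qed (use b in \<open>auto simp: sol_tau_def brace_solution_def\<close>)

theorem brace_solution_is_solution: "ybe_solution C r"
  unfolding ybe_solution_def
  using r_bij r_braid sigma_bij tau_bij additive.one_closed by blast

end

end

theory Submission
  imports Defs
begin

text \<open>
  Write \<open>\<oplus>\<close> for the additive and \<open>\<odot>\<close> for the multiplicative operation. Both sides of the
  equivalence say that \<open>\<gamma>\<close> is an anti-homomorphism on the additive group:
  \<open>\<gamma>(a \<oplus> b) = \<gamma>(b) \<gamma>(a)\<close> for all \<open>a\<close> and \<open>b\<close>.

  For the bi-skew brace property this comes from writing \<open>a \<odot> b = a \<oplus> \<gamma>(a)(b)\<close> in both sides of
  the compatibility law with exchanged operations: the left-hand side \<open>a \<oplus> (b \<odot> c)\<close> becomes
  \<open>a \<oplus> b \<oplus> \<gamma>(b)(c)\<close>, and, since \<open>a \<oplus> c = a \<odot> \<gamma>(a)\<inverse>(c)\<close>, the right-hand side becomes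
  \<open>a \<oplus> b \<oplus> \<gamma>(a \<oplus> b)(\<gamma>(a)\<inverse>(c))\<close>. This is \<open>skew_brace_swap_iff\<close>.

  For the condition on the solution, inverting the map gives \<open>(x \<odot> y) \<oplus> x\<^sup>-\<close> for the first
  component of the inverse at \<open>(x, y)\<close>, where \<open>x\<^sup>-\<close> is the additive inverse
  (\<open>inverse_solution_fst\<close>). The substitution \<open>x \<odot> y = b \<oplus> x\<close> then turns
  \<open>\<gamma>((x \<odot> y) \<oplus> x\<^sup>-) = \<gamma>(y)\<close> into \<open>\<gamma>(b) = \<gamma>(x)\<inverse> \<gamma>(b \<oplus> x)\<close>, because \<open>\<gamma>\<close> is multiplicative.
  This is \<open>hat_condition_iff\<close>.
\<close>

context skew_brace
begin

lemma skew_brace_swap_iff: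
  "skew_brace M A \<longleftrightarrow>
    (\<forall>a\<in>C. \<forall>b\<in>C. \<forall>c\<in>C. g (a \<oplus> b) c = g b (g a c))"
proof -
  have lhs: "a \<oplus> b \<odot> c = (a \<oplus> b) \<oplus> g b c" if "a \<in> C" "b \<in> C" "c \<in> C" for a b c
    using that by (simp add: mul_eq additive.m_assoc)
  have rhs: "(a \<oplus> b) \<odot> iM a \<odot> (a \<oplus> c) = (a \<oplus> b) \<oplus> g (a \<oplus> b) (g (iM a) c)"
    if "a \<in> C" "b \<in> C" "c \<in> C" for a b c
  proof -
    have "a \<oplus> c = a \<odot> g (iM a) c"
      using that by (simp add: mul_eq gamma_inv)
    then have "(a \<oplus> b) \<odot> iM a \<odot> (a \<oplus> c) = (a \<oplus> b) \<odot> g (iM a) c"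
      using that by (simp add: mul_assoc mul_inv_cancel)
    then show ?thesis
      using that by (simp add: mul_eq)
  qed
  have law: "(a \<oplus> b \<odot> c = (a \<oplus> b) \<odot> iM a \<odot> (a \<oplus> c)) \<longleftrightarrow>
      g (a \<oplus> b) (g (iM a) c) = g b c" if "a \<in> C" "b \<in> C" "c \<in> C" for a b c
    unfolding lhs[OF that] rhs[OF that] using that by auto
  have "skew_brace M A \<longleftrightarrow>
      (\<forall>a\<in>C. \<forall>b\<in>C. \<forall>c\<in>C. a \<oplus> b \<odot> c = (a \<oplus> b) \<odot> iM a \<odot> (a \<oplus> c))"
    unfolding skew_brace_def skew_brace_axioms_def carrier_eq
    by (simp add: Ball_def additive.is_group multiplicative.is_group)
  also have "\<dots> \<longleftrightarrow> (\<forall>a\<in>C. \<forall>b\<in>C. \<forall>c\<in>C. g (a \<oplus> b) (g (iM a) c) = g b c)"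
    by (simp add: law)
  also have "\<dots> \<longleftrightarrow> (\<forall>a\<in>C. \<forall>b\<in>C. \<forall>c\<in>C. g (a \<oplus> b) c = g b (g a c))"
  proof (intro iffI ballI)
    fix a b c assume *: "\<forall>a\<in>C. \<forall>b\<in>C. \<forall>c\<in>C. g (a \<oplus> b) (g (iM a) c) = g b c"
      and abc: "a \<in> C" "b \<in> C" "c \<in> C"
    show "g (a \<oplus> b) c = g b (g a c)"
      using *[rule_format, of a b "g a c"] abc by (simp add: gamma_inv)
  next
    fix a b c assume *: "\<forall>a\<in>C. \<forall>b\<in>C. \<forall>c\<in>C. g (a \<oplus> b) c = g b (g a c)"
      and abc: "a \<in> C" "b \<in> C" "c \<in> C"
    show "g (a \<oplus> b) (g (iM a) c) = g b c"
      using *[rule_format, of a b "g (iM a) c"] abc by (simp add: gamma_inv)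
  qed
  finally show ?thesis .
qed

text \<open>
  A preimage \<open>(a, b)\<close> of \<open>(x, y)\<close> satisfies \<open>\<gamma>(a)(b) = x\<close> and \<open>a \<odot> b = x \<odot> y\<close>; as
  \<open>a \<odot> b = a \<oplus> \<gamma>(a)(b)\<close>, this leaves \<open>a \<oplus> x = x \<odot> y\<close>.
\<close>
lemma inverse_solution_fst:
  assumes "x \<in> C" "y \<in> C"
  shows "fst (inverse_solution C r (x, y)) = x \<odot> y \<oplus> iA x"
proof -
  obtain a b where ab: "a \<in> C" "b \<in> C" and r: "r (a, b) = (x, y)"
  proof -
    have "(x, y) \<in> r ` (C \<times> C)"
      using assms bij_betw_imp_surj_on[OF r_bij] by simp
    then show thesis using that by auto
  qed
  have "x \<odot> y = a \<oplus> x"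
    using r_mul[OF ab] r_fst[of a b] r mul_eq[OF ab] by simp
  then have "x \<odot> y \<oplus> iA x = a"
    using ab assms by (simp add: additive.m_assoc)
  moreover have "inverse_solution C r (x, y) = (a, b)"
    unfolding inverse_solution_def
    using ab by (intro inv_into_f_eq[OF bij_betw_imp_inj_on[OF r_bij]]) (simp_all add: r)
  ultimately show ?thesis by simp
qed

lemma sol_sigma_eq_iff:
  "sol_sigma C r x = sol_sigma C r y \<longleftrightarrow> (\<forall>c\<in>C. g x c = g y c)"
  by (auto simp: sol_sigma_def r_fst restrict_def fun_eq_iff)

lemma hat_condition_iff:
  "(\<forall>x\<in>C. \<forall>y\<in>C. \<forall>c\<in>C. g (x \<odot> y \<oplus> iA x) c = g y c) \<longleftrightarrow>
    (\<forall>a\<in>C. \<forall>b\<in>C. \<forall>c\<in>C. g (a \<oplus> b) c = g b (g a c))"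
    (is "?hat \<longleftrightarrow> ?anti")
proof
  assume hat: ?hat
  show ?anti
  proof (intro ballI)
    fix a b c assume abc: "a \<in> C" "b \<in> C" "c \<in> C"
    \<comment> \<open>The second argument of the hypothesis is chosen so that \<open>b \<odot> y = a \<oplus> b\<close>.\<close>
    define y where "y = iM b \<odot> (a \<oplus> b)"
    have y: "y \<in> C" "b \<odot> y = a \<oplus> b"
      using abc by (simp_all add: y_def mul_inv_cancel)
    have "b \<odot> y \<oplus> iA b = a"
      using abc y by (simp add: additive.m_assoc)
    then have "g a c = g y c"
      using hat[rule_format, of b y c] abc y(1) by simp
    then show "g (a \<oplus> b) c = g b (g a c)"
      using abc y gamma_mul[of b y c] by simp
  qed
next
  assume anti: ?anti
  show ?hat
  proof (intro ballI)
    fix x y c assume xyc: "x \<in> C" "y \<in> C" "c \<in> C"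
    let ?a = "x \<odot> y \<oplus> iA x"
    have a: "?a \<in> C" "?a \<oplus> x = x \<odot> y"
      using xyc by (simp_all add: additive.m_assoc)
    have "g x (g ?a c) = g (?a \<oplus> x) c"
      by (rule anti[rule_format, symmetric]) (use a(1) xyc in auto)
    also have "\<dots> = g x (g y c)"
      unfolding a(2) by (rule gamma_mul) (use xyc in auto)
    finally have "g (iM x) (g x (g ?a c)) = g (iM x) (g x (g y c))"
      by (rule arg_cong)
    then show "g ?a c = g y c"
      using a(1) xyc by (simp only: gamma_inv gamma_closed)
  qed
qed

lemma bi_skew_brace_iff_sol_sigma:
  "bi_skew_brace A M \<longleftrightarrow>
    (\<forall>x\<in>C. \<forall>y\<in>C.
       sol_sigma C r (sol_sigma C (inverse_solution C r) x y) = sol_sigma C r y)"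
proof -
  have hat: "sol_sigma C (inverse_solution C r) x y = x \<odot> y \<oplus> iA x"
    if "x \<in> C" "y \<in> C" for x y
    using that inverse_solution_fst[OF that] by (simp add: sol_sigma_def)
  show ?thesis
    unfolding bi_skew_brace_def skew_brace_swap_iff hat_condition_iff[symmetric]
    using skew_brace_axioms by (simp add: hat sol_sigma_eq_iff)
qed

end

theorem proposition5p2:
  fixes A :: "('a, 'm) monoid_scheme" and M :: "('a, 'n) monoid_scheme"
  assumes "skew_brace A M"
  shows "bi_skew_brace A M \<longleftrightarrow>
    (\<forall>x \<in> carrier A. \<forall>y \<in> carrier A.
       sol_sigma (carrier A) (brace_solution A M)
         (sol_sigma (carrier A) (inverse_solution (carrier A) (brace_solution A M)) x y)
       = sol_sigma (carrier A) (brace_solution A M) y)"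
  using assms by (rule skew_brace.bi_skew_brace_iff_sol_sigma)

end
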